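(* Let $k\in\mathbb{Z}_{\ge 0}$. Every $k$-generalized Cohn triple $(P,Q,R)$ associated with a $k$-generalized Markov triple $(a,b,c)$ satisfying $b\geq \max\{a,c\}$ is obtained by applying the transformations $$(P,Q,R)\mapsto (P,PQ-S,Q)\quad \text{or} \quad (P,Q,R)\mapsto (Q,QR-S,R)$$ successively (finitely many times, possibly zero) to a $k$-generalized Cohn triple associated with $(1,1,1)$. Moreover, the transformations of the $(1,2)$-entries induced by these two maps on $k$-generalized Cohn triples coincide with the Vieta jumpings of the $k$-generalized Markov triples; that is, if $(P,Q,R)$ is a $k$-generalized Cohn triple with $(1,2)$-entries $(a,b,c)$, then the $(1,2)$-entries of $(P,PQ-S,Q)$ are $\left(a,\frac{a^2+kab+b^2}{c},b\right)$ and those of $(Q,QR-S,R)$ are $\left(b,\frac{b^2+kbc+c^2}{a},c\right)$.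
   Context: Fix $k\in\mathbb{Z}_{\ge 0}$. A $k$-generalized Markov triple is a positive integer solution $(a,b,c)$ of $x^2+y^2+z^2+k(yz+zx+xy)=(3+3k)xyz$; a $k$-generalized Markov number is an entry of such a triple. Put $S=\begin{bmatrix} k&0\\ 3k^2+3k&k\end{bmatrix}$. A $k$-generalized Cohn matrix is $P=\begin{bmatrix} p_{11}&p_{12}\\ p_{21}&p_{22}\end{bmatrix}\in SL(2,\mathbb{Z})$ such that $p_{12}$ is a $k$-generalized Markov number and $\mathrm{tr}(P)=(3+3k)p_{12}-k$. A $k$-generalized Cohn triple is a triple $(P,Q,R)$ of $k$-generalized Cohn matrices such that $Q=PR-S$ and the triple $(p_{12},q_{12},r_{12})$ of $(1,2)$-entries of $P,Q,R$ is a $k$-generalized Markov triple; $(P,Q,R)$ is then said to be associated with $(p_{12},q_{12},r_{12})$. The Vieta jumpings of $k$-generalized Markov triples are $(a,b,c)\mapsto \left(a,\frac{a^2+kab+b^2}{c},b\right)$ and $(a,b,c)\mapsto \left(b,\frac{b^2+kbc+c^2}{a},c\right)$. *)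

theory Defs
  imports "HOL-Analysis.Determinants"
begin

definition markov_triple :: "int \<Rightarrow> int \<times> int \<times> int \<Rightarrow> bool" where
  "markov_triple k = (\<lambda>(a, b, c). a > 0 \<and> b > 0 \<and> c > 0 \<and>
     a\<^sup>2 + b\<^sup>2 + c\<^sup>2 + k * (b * c + c * a + a * b) = (3 + 3 * k) * a * b * c)"

definition markov_number :: "int \<Rightarrow> int \<Rightarrow> bool" where
  "markov_number k n \<longleftrightarrow> (\<exists>a b c. markov_triple k (a, b, c) \<and> n \<in> {a, b, c})"

definition S_mat :: "int \<Rightarrow> int^2^2" where
  "S_mat k = vector [vector [k, 0], vector [3 * k\<^sup>2 + 3 * k, k]]"

definition cohn_matrix :: "int \<Rightarrow> int^2^2 \<Rightarrow> bool" where
  "cohn_matrix k P \<longleftrightarrow> det P = 1 \<and> markov_number k (P $ 1 $ 2) \<and>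
     trace P = (3 + 3 * k) * P $ 1 $ 2 - k"

type_synonym mat_triple = "(int^2^2) \<times> (int^2^2) \<times> (int^2^2)"

definition entries12 :: "mat_triple \<Rightarrow> int \<times> int \<times> int" where
  "entries12 = (\<lambda>(P, Q, R). (P $ 1 $ 2, Q $ 1 $ 2, R $ 1 $ 2))"

definition cohn_triple :: "int \<Rightarrow> mat_triple \<Rightarrow> bool" where
  "cohn_triple k = (\<lambda>(P, Q, R). cohn_matrix k P \<and> cohn_matrix k Q \<and> cohn_matrix k R \<and>
     Q = P ** R - S_mat k \<and> markov_triple k (entries12 (P, Q, R)))"

definition cohn_triple_assoc :: "int \<Rightarrow> mat_triple \<Rightarrow> int \<times> int \<times> int \<Rightarrow> bool" where
  "cohn_triple_assoc k T m \<longleftrightarrow> cohn_triple k T \<and> entries12 T = m"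

definition cohn_left :: "int \<Rightarrow> mat_triple \<Rightarrow> mat_triple" where
  "cohn_left k = (\<lambda>(P, Q, R). (P, P ** Q - S_mat k, Q))"

definition cohn_right :: "int \<Rightarrow> mat_triple \<Rightarrow> mat_triple" where
  "cohn_right k = (\<lambda>(P, Q, R). (Q, Q ** R - S_mat k, R))"

inductive cohn_step :: "int \<Rightarrow> mat_triple \<Rightarrow> mat_triple \<Rightarrow> bool" for k where
  left: "cohn_step k T (cohn_left k T)"
| right: "cohn_step k T (cohn_right k T)"

(* The Vieta jumpings take values in rational triples: the fraction is then a genuine
   quotient, and an equation with an integer triple also asserts that the division is exact. *)

definition vieta_left :: "int \<Rightarrow> int \<times> int \<times> int \<Rightarrow> rat \<times> rat \<times> rat" where
  "vieta_left k = (\<lambda>(a, b, c).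
     (of_int a, of_int (a\<^sup>2 + k * a * b + b\<^sup>2) / of_int c, of_int b))"

definition vieta_right :: "int \<Rightarrow> int \<times> int \<times> int \<Rightarrow> rat \<times> rat \<times> rat" where
  "vieta_right k = (\<lambda>(a, b, c).
     (of_int b, of_int (b\<^sup>2 + k * b * c + c\<^sup>2) / of_int a, of_int c))"

definition rat_triple :: "int \<times> int \<times> int \<Rightarrow> rat \<times> rat \<times> rat" where
  "rat_triple = (\<lambda>(a, b, c). (of_int a, of_int b, of_int c))"

end

(* Both maps run backwards: if Q = P R - S, then (P, Q, R) is the left image of (P, R, P^-1 (R + S))
   and the right image of ((P + S) R^-1, P, R). The trace condition makes these again Cohn triples
   (in particular it gives det (R + S) = 1), and the new (1,2)-entry is the second root of the
   Markov equation viewed as a quadratic in the entry b of Q. If b is maximal and the triple is not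
   (1, 1, 1), this root is positive and at most max a c < b; dropping the side with the smaller
   entry therefore yields a triple with smaller, still maximal, middle entry. *)

theory Submission
  imports Defs
begin

section \<open>Matrices by their entries\<close>

text \<open>A constructor with simp rules for product and difference, so that matrix identities
  become polynomial identities in integer entries, which \<open>algebra\<close> can settle.\<close>

definition mat2 :: "'a \<Rightarrow> 'a \<Rightarrow> 'a \<Rightarrow> 'a \<Rightarrow> 'a::zero^2^2" where
  "mat2 p q r s = vector [vector [p, q], vector [r, s]]"

lemma mat2_nth [simp]:
  "mat2 p q r s $ 1 $ 1 = p" "mat2 p q r s $ 1 $ 2 = q"
  "mat2 p q r s $ 2 $ 1 = r" "mat2 p q r s $ 2 $ 2 = s"
  by (simp_all add: mat2_def)

lemma mat2_eta: "mat2 (M $ 1 $ 1) (M $ 1 $ 2) (M $ 2 $ 1) (M $ 2 $ 2) = M"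
  by (simp add: vec_eq_iff forall_2)

lemma mat2_exhaust:
  obtains p q r s where "M = mat2 p q r s"
  using mat2_eta by metis

lemma mat2_eq_iff [simp]:
  "mat2 p q r s = mat2 p' q' r' s' \<longleftrightarrow> p = p' \<and> q = q' \<and> r = r' \<and> s = s'"
  by (auto simp: vec_eq_iff forall_2)

lemma mat2_mult [simp]:
  "mat2 p q r s ** mat2 p' q' r' s' =
    mat2 (p * p' + q * r') (p * q' + q * s') (r * p' + s * r') (r * q' + s * s')"
  for p :: "'a::semiring_1"
  by (simp add: vec_eq_iff forall_2 matrix_matrix_mult_def sum_2)

lemma mat2_diff [simp]:
  "mat2 p q r s - mat2 p' q' r' s' = mat2 (p - p') (q - q') (r - r') (s - s')"
  for p :: "'a::group_add"
  by (simp add: vec_eq_iff forall_2)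

lemma S_mat_eq: "S_mat k = mat2 k 0 (3 * k\<^sup>2 + 3 * k) k"
  by (simp add: S_mat_def mat2_def)

lemma cohn_matrix_mat2:
  "cohn_matrix k (mat2 p q r s) \<longleftrightarrow>
    p * s - q * r = 1 \<and> markov_number k q \<and> p + s = (3 + 3 * k) * q - k"
  by (simp add: cohn_matrix_def det_2 trace_def sum_2)

lemma markov_triple_imp_markov_number:
  assumes "markov_triple k (a, b, c)"
  shows "markov_number k a" "markov_number k b" "markov_number k c"
  using assms unfolding markov_number_def by blast+

section \<open>The second root of the Markov equation\<close>

text \<open>The equation is monic quadratic in \<open>b\<close>, and \<open>b'\<close> is the sum of
  its roots minus \<open>b\<close>. The two orderings serve the left and the right preimage
  respectively.\<close>

lemma markov_triple_middle_swap:
  assumes k: "k \<ge> 0" and m: "markov_triple k (a, b, c)"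
  defines "b' \<equiv> (3 + 3 * k) * a * c - k * (a + c) - b"
  shows "markov_triple k (a, c, b')" "markov_triple k (b', a, c)"
proof -
  have pos: "a > 0" "b > 0" "c > 0"
    and eq: "a\<^sup>2 + b\<^sup>2 + c\<^sup>2 + k * (b * c + c * a + a * b) = (3 + 3 * k) * a * b * c"
    using m by (auto simp: markov_triple_def)
  \<comment> \<open>The product of the roots is positive, and hence so is the second root.\<close>
  have "b * b' = a\<^sup>2 + c\<^sup>2 + k * (a * c)"
    unfolding b'_def using eq by (simp add: algebra_simps power2_eq_square)
  moreover have "\<dots> > 0"
    using pos k by (intro add_pos_nonneg add_pos_pos) auto
  ultimately have "b' > 0"
    using pos(2) by (metis zero_less_mult_pos)
  moreover have "a\<^sup>2 + c\<^sup>2 + b'\<^sup>2 + k * (c * b' + b' * a + a * c) = (3 + 3 * k) * a * c * b'"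
    unfolding b'_def using eq by algebra
  ultimately show "markov_triple k (a, c, b')" "markov_triple k (b', a, c)"
    using pos by (auto simp: markov_triple_def algebra_simps)
qed

text \<open>The quadratic is nonpositive at the larger outer entry \<open>M\<close>, so
  \<open>M\<close> lies between the two roots; as \<open>b\<close> is at least \<open>M\<close>, it
  is the upper root.\<close>

lemma markov_triple_middle_swap_le:
  assumes k: "k \<ge> 0" and m: "markov_triple k (a, b, c)"
    and b: "b \<ge> a" "b \<ge> c" and ne: "(a, b, c) \<noteq> (1, 1, 1)"
  defines "b' \<equiv> (3 + 3 * k) * a * c - k * (a + c) - b"
  shows "max a c < b" "b' \<le> max a c"
proof -
  have pos: "a > 0" "b > 0" "c > 0"
    and eq: "a\<^sup>2 + b\<^sup>2 + c\<^sup>2 + k * (b * c + c * a + a * b) = (3 + 3 * k) * a * b * c"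
    using m by (auto simp: markov_triple_def)
  \<comment> \<open>The equation and \<open>b'\<close> are symmetric in \<open>a\<close> and
    \<open>c\<close>, so only their minimum and maximum matter.\<close>
  define M where "M = max a c"
  define n where "n = min a c"
  have n: "1 \<le> n" "n \<le> M" and "M \<le> b"
    using pos b by (auto simp: n_def M_def)
  have eq': "n\<^sup>2 + b\<^sup>2 + M\<^sup>2 + k * (b * M + M * n + n * b) = (3 + 3 * k) * n * b * M"
    and b': "b' = (3 + 3 * k) * n * M - k * (n + M) - b"
    using eq by (auto simp: n_def M_def b'_def max_def min_def algebra_simps)
  \<comment> \<open>The quadratic with roots \<open>b\<close> and \<open>b'\<close>, evaluated at \<open>M\<close>.\<close>
  have f: "(M - b) * (M - b') = (n\<^sup>2 - M\<^sup>2) + 2 * k * (M * (n - M)) + (3 + 3 * k) * (M\<^sup>2 * (1 - n))"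
    unfolding b' using eq' by algebra
  have "n\<^sup>2 \<le> M\<^sup>2"
    using n by (intro power_mono) auto
  moreover have "k * (M * (n - M)) \<le> 0"
    using n k by (simp add: mult_nonneg_nonpos)
  moreover have "(3 + 3 * k) * (M\<^sup>2 * (1 - n)) \<le> 0"
    using n k by (simp add: mult_nonneg_nonpos)
  \<comment> \<open>All three summands are nonpositive, so a zero sum makes each of them
    vanish.\<close>
  ultimately have fle: "(M - b) * (M - b') \<le> 0"
    and f0: "(M - b) * (M - b') = 0 \<Longrightarrow> n\<^sup>2 = M\<^sup>2 \<and> (3 + 3 * k) * (M\<^sup>2 * (1 - n)) = 0"
    unfolding f by linarith+
  \<comment> \<open>Equality would force \<open>n = M\<close> and \<open>n = 1\<close>, hence the
    excluded triple of ones.\<close>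
  have "M \<noteq> b"
  proof
    assume "M = b"
    then have "n\<^sup>2 = M\<^sup>2" "(3 + 3 * k) * (M\<^sup>2 * (1 - n)) = 0"
      using f0 by simp_all
    then have "n = M" "n = 1"
      using n k by auto
    then show False
      using \<open>M = b\<close> ne by (auto simp: M_def n_def max_def min_def split: if_splits)
  qed
  with \<open>M \<le> b\<close> show "max a c < b"
    unfolding M_def by linarith
  then show "b' \<le> max a c"
    using fle by (auto simp: M_def mult_le_0_iff)
qed

section \<open>Inverting the two maps\<close>

lemma cohn_left_preimage:
  assumes k: "k \<ge> 0" and T: "cohn_triple_assoc k (P, Q, R) (a, b, c)"
  obtains X where "cohn_left k (P, R, X) = (P, Q, R)"
    "cohn_triple_assoc k (P, R, X) (a, c, (3 + 3 * k) * a * c - k * (a + c) - b)"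
proof -
  obtain p1 p2 p3 p4 where P: "P = mat2 p1 p2 p3 p4" by (rule mat2_exhaust)
  obtain r1 r2 r3 r4 where R: "R = mat2 r1 r2 r3 r4" by (rule mat2_exhaust)
  have Q: "Q = P ** R - S_mat k" and entries: "p2 = a" "Q $ 1 $ 2 = b" "r2 = c"
    and m: "markov_triple k (a, b, c)"
    and coP: "cohn_matrix k P" and coQ: "cohn_matrix k Q" and coR: "cohn_matrix k R"
    using T by (auto simp: cohn_triple_assoc_def cohn_triple_def entries12_def P R)
  have b: "b = p1 * c + a * r4"
    using entries by (simp add: Q P R S_mat_eq)
  have p: "p1 * p4 - a * p3 = 1" "p1 + p4 = (3 + 3 * k) * a - k"
    using coP entries by (simp_all add: P cohn_matrix_mat2)
  have r: "r1 * r4 - c * r3 = 1" "r1 + r4 = (3 + 3 * k) * c - k"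
    using coR entries by (simp_all add: R cohn_matrix_mat2)
  have q: "p1 * r1 + a * r3 - k + (p3 * c + p4 * r4 - k) = (3 + 3 * k) * b - k"
    using coQ entries by (simp add: Q P R S_mat_eq cohn_matrix_mat2)
  define b' where "b' = (3 + 3 * k) * a * c - k * (a + c) - b"
  have m': "markov_triple k (a, c, b')"
    unfolding b'_def by (rule markov_triple_middle_swap[OF k m])
  \<comment> \<open>\<open>s\<close> is the lower left entry of S. Below, \<open>X\<close> is the
    adjugate of \<open>P\<close> times R + S, that is P^-1 (R + S), because det P = 1.\<close>
  define s where "s = 3 * k\<^sup>2 + 3 * k"
  define X where "X = mat2 (p4 * (r1 + k) - a * (r3 + s)) (p4 * c - a * (r4 + k))
    (p1 * (r3 + s) - p3 * (r1 + k)) (p1 * (r4 + k) - p3 * c)"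
  \<comment> \<open>The trace of \<open>P\<close> eliminates \<open>p4\<close>, and the remaining
    terms p1 c + a r4 are \<open>b\<close>.\<close>
  have x2: "p4 * c - a * (r4 + k) = b'"
    unfolding b'_def b using p(2) by algebra
  have PX: "P ** X - S_mat k = R"
    unfolding P R X_def mat2_mult S_mat_eq mat2_diff mat2_eq_iff entries s_def[symmetric]
    using p(1) by (intro conjI) algebra+
  have "(p4 * (r1 + k) - a * (r3 + s)) * (p1 * (r4 + k) - p3 * c)
      - b' * (p1 * (r3 + s) - p3 * (r1 + k)) = (p1 * p4 - a * p3) * ((r1 + k) * (r4 + k) - c * (r3 + s))"
    unfolding x2[symmetric] by algebra
  \<comment> \<open>det (R + S) = det R + k tr R + k^2 - c s, and the trace condition on
    \<open>R\<close> makes the last three terms cancel.\<close>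
  also have "\<dots> = 1"
    unfolding p(1) s_def using r by algebra
  finally have det: "(p4 * (r1 + k) - a * (r3 + s)) * (p1 * (r4 + k) - p3 * c)
      - b' * (p1 * (r3 + s) - p3 * (r1 + k)) = 1" .
  \<comment> \<open>Since P + P^-1 = tr(P) I, tr(P^-1 R) = tr P tr R - tr(P R), where tr(P R) = tr Q
    + 2 k. Moreover tr(P^-1 S) = k tr P - a s = -k^2.\<close>
  have tr: "p4 * (r1 + k) - a * (r3 + s) + (p1 * (r4 + k) - p3 * c) = (3 + 3 * k) * b' - k"
    unfolding b'_def s_def using p(2) r(2) q by algebra
  have "cohn_matrix k X"
    using det tr markov_triple_imp_markov_number(3)[OF m'] by (simp add: X_def x2 cohn_matrix_mat2)
  then have "cohn_triple_assoc k (P, R, X) (a, c, b')"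
    using coP coR PX m' entries x2
    by (simp add: cohn_triple_assoc_def cohn_triple_def entries12_def P R X_def)
  moreover have "cohn_left k (P, R, X) = (P, Q, R)"
    by (simp add: cohn_left_def Q)
  ultimately show thesis
    using that by (simp add: b'_def)
qed

text \<open>Mirror image of the left case: the preimage is (P + S) R^-1, and the trace condition on
  \<open>P\<close> gives det (P + S) = 1.\<close>

lemma cohn_right_preimage:
  assumes k: "k \<ge> 0" and T: "cohn_triple_assoc k (P, Q, R) (a, b, c)"
  obtains X where "cohn_right k (X, P, R) = (P, Q, R)"
    "cohn_triple_assoc k (X, P, R) ((3 + 3 * k) * a * c - k * (a + c) - b, a, c)"
proof -
  obtain p1 p2 p3 p4 where P: "P = mat2 p1 p2 p3 p4" by (rule mat2_exhaust)
  obtain r1 r2 r3 r4 where R: "R = mat2 r1 r2 r3 r4" by (rule mat2_exhaust)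
  have Q: "Q = P ** R - S_mat k" and entries: "p2 = a" "Q $ 1 $ 2 = b" "r2 = c"
    and m: "markov_triple k (a, b, c)"
    and coP: "cohn_matrix k P" and coQ: "cohn_matrix k Q" and coR: "cohn_matrix k R"
    using T by (auto simp: cohn_triple_assoc_def cohn_triple_def entries12_def P R)
  have b: "b = p1 * c + a * r4"
    using entries by (simp add: Q P R S_mat_eq)
  have p: "p1 * p4 - a * p3 = 1" "p1 + p4 = (3 + 3 * k) * a - k"
    using coP entries by (simp_all add: P cohn_matrix_mat2)
  have r: "r1 * r4 - c * r3 = 1" "r1 + r4 = (3 + 3 * k) * c - k"
    using coR entries by (simp_all add: R cohn_matrix_mat2)
  have q: "p1 * r1 + a * r3 - k + (p3 * c + p4 * r4 - k) = (3 + 3 * k) * b - k"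
    using coQ entries by (simp add: Q P R S_mat_eq cohn_matrix_mat2)
  define b' where "b' = (3 + 3 * k) * a * c - k * (a + c) - b"
  have m': "markov_triple k (b', a, c)"
    unfolding b'_def by (rule markov_triple_middle_swap[OF k m])
  define s where "s = 3 * k\<^sup>2 + 3 * k"
  define X where "X = mat2 ((p1 + k) * r4 - a * r3) (a * r1 - (p1 + k) * c)
    ((p3 + s) * r4 - (p4 + k) * r3) ((p4 + k) * r1 - (p3 + s) * c)"
  have x2: "a * r1 - (p1 + k) * c = b'"
    unfolding b'_def b using r(2) by algebra
  have XR: "X ** R - S_mat k = P"
    unfolding P R X_def mat2_mult S_mat_eq mat2_diff mat2_eq_iff entries s_def[symmetric]
    using r(1) by (intro conjI) algebra+
  have "((p1 + k) * r4 - a * r3) * ((p4 + k) * r1 - (p3 + s) * c)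
      - b' * ((p3 + s) * r4 - (p4 + k) * r3) = ((p1 + k) * (p4 + k) - a * (p3 + s)) * (r1 * r4 - c * r3)"
    unfolding x2[symmetric] by algebra
  also have "\<dots> = 1"
    unfolding r(1) s_def using p by algebra
  finally have det: "((p1 + k) * r4 - a * r3) * ((p4 + k) * r1 - (p3 + s) * c)
      - b' * ((p3 + s) * r4 - (p4 + k) * r3) = 1" .
  \<comment> \<open>As on the left side, now with tr(P R^-1) = tr P tr R - tr(P R) and tr(S R^-1) =
    k tr R - c s = -k^2.\<close>
  have tr: "(p1 + k) * r4 - a * r3 + ((p4 + k) * r1 - (p3 + s) * c) = (3 + 3 * k) * b' - k"
    unfolding b'_def s_def using p(2) r(2) q by algebra
  have "cohn_matrix k X"
    using det tr markov_triple_imp_markov_number(1)[OF m'] by (simp add: X_def x2 cohn_matrix_mat2)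
  then have "cohn_triple_assoc k (X, P, R) (b', a, c)"
    using coP coR XR m' entries x2
    by (simp add: cohn_triple_assoc_def cohn_triple_def entries12_def P R X_def)
  moreover have "cohn_right k (X, P, R) = (P, Q, R)"
    by (simp add: cohn_right_def Q)
  ultimately show thesis
    using that by (simp add: b'_def)
qed

section \<open>Descent to the triple of ones\<close>

lemma cohn_triple_descent:
  assumes k: "k \<ge> 0" and T: "cohn_triple_assoc k T (a, b, c)" and b: "b \<ge> a" "b \<ge> c"
  shows "\<exists>T0. cohn_triple_assoc k T0 (1, 1, 1) \<and> (cohn_step k)\<^sup>*\<^sup>* T0 T"
  using T b
proof (induction "nat b" arbitrary: T a b c rule: less_induct)
  case less
  show ?case
  proof (cases "(a, b, c) = (1, 1, 1)")
    case True
    with less.prems show ?thesis by blast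
  next
    case False
    obtain P Q R where T: "T = (P, Q, R)" by (cases T)
    have assoc: "cohn_triple_assoc k (P, Q, R) (a, b, c)"
      using less.prems T by simp
    then have m: "markov_triple k (a, b, c)"
      by (auto simp: cohn_triple_assoc_def cohn_triple_def)
    then have pos: "b > 0" by (simp add: markov_triple_def)
    define b' where "b' = (3 + 3 * k) * a * c - k * (a + c) - b"
    have lt: "max a c < b" and le: "b' \<le> max a c"
      using markov_triple_middle_swap_le[OF k m less.prems(2,3) False] by (auto simp: b'_def)
    \<comment> \<open>The preimage is chosen so that the larger of \<open>a\<close> and
      \<open>c\<close> becomes the new middle entry \<open>m'\<close>; then
      \<open>b' \<le> max a c\<close> keeps the middle entry maximal.\<close>
    have "\<exists>T' a' m' c'. cohn_step k T' T \<and> cohn_triple_assoc k T' (a', m', c') \<and>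
        m' < b \<and> a' \<le> m' \<and> c' \<le> m'"
    proof (cases "a \<le> c")
      case True
      obtain X where X: "cohn_left k (P, R, X) = (P, Q, R)" "cohn_triple_assoc k (P, R, X) (a, c, b')"
        using cohn_left_preimage[OF k assoc] unfolding b'_def by metis
      have "cohn_step k (P, R, X) T"
        using cohn_step.left[of k "(P, R, X)"] X(1) T by simp
      moreover have "c < b" "b' \<le> c"
        using lt le True by auto
      ultimately show ?thesis
        using X(2) True by blast
    next
      case False
      obtain X where X: "cohn_right k (X, P, R) = (P, Q, R)" "cohn_triple_assoc k (X, P, R) (b', a, c)"
        using cohn_right_preimage[OF k assoc] unfolding b'_def by metis
      have "cohn_step k (X, P, R) T"
        using cohn_step.right[of k "(X, P, R)"] X(1) T by simp
      moreover have "a < b" "b' \<le> a" "c \<le> a"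
        using lt le False by auto
      ultimately show ?thesis
        using X(2) by blast
    qed
    then obtain T' a' m' c' where T': "cohn_step k T' T" "cohn_triple_assoc k T' (a', m', c')"
      "m' < b" "a' \<le> m'" "c' \<le> m'"
      by blast
    \<comment> \<open>Positivity of \<open>b\<close> turns \<open>m' < b\<close> into a decrease of
      the measure \<open>nat b\<close>.\<close>
    then obtain T0 where "cohn_triple_assoc k T0 (1, 1, 1)" "(cohn_step k)\<^sup>*\<^sup>* T0 T'"
      using less.hyps[of m' T' a' c'] pos by auto
    with T'(1) show ?thesis
      by (meson rtranclp.rtrancl_into_rtrancl)
  qed
qed

section \<open>The induced Vieta jumpings\<close>

text \<open>By Cayley-Hamilton, P Q = P^2 R - P S = tr(P) P R - R - P S; its (1,2) entry is tr(P) b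
  - c - k a, and S contributes 0 there. On the other side, Q R = tr(R) P R - P - S R.\<close>

lemma entries12_cohn_step:
  assumes "cohn_triple k T" and "entries12 T = (a, b, c)"
  shows "entries12 (cohn_left k T) = (a, (3 + 3 * k) * a * b - k * (a + b) - c, b)"
    and "entries12 (cohn_right k T) = (b, (3 + 3 * k) * b * c - k * (b + c) - a, c)"
proof -
  obtain P Q R where T: "T = (P, Q, R)" by (cases T)
  obtain p1 p2 p3 p4 where P: "P = mat2 p1 p2 p3 p4" by (rule mat2_exhaust)
  obtain r1 r2 r3 r4 where R: "R = mat2 r1 r2 r3 r4" by (rule mat2_exhaust)
  have Q: "Q = P ** R - S_mat k" and entries: "p2 = a" "Q $ 1 $ 2 = b" "r2 = c"
    and coP: "cohn_matrix k P" and coR: "cohn_matrix k R"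
    using assms by (auto simp: cohn_triple_def entries12_def T P R)
  have b: "p1 * c + a * r4 = b"
    using entries by (simp add: Q P R S_mat_eq)
  have p: "p1 * p4 - a * p3 = 1" "p1 + p4 = (3 + 3 * k) * a - k"
    using coP entries by (simp_all add: P cohn_matrix_mat2)
  have r: "r1 * r4 - c * r3 = 1" "r1 + r4 = (3 + 3 * k) * c - k"
    using coR entries by (simp_all add: R cohn_matrix_mat2)
  have "p1 * b + a * (p3 * c + p4 * r4 - k) = (p1 + p4) * b - k * a - (p1 * p4 - a * p3) * c"
    unfolding b[symmetric] by algebra
  also have "\<dots> = (3 + 3 * k) * a * b - k * (a + b) - c"
    unfolding p by algebra
  finally show "entries12 (cohn_left k T) = (a, (3 + 3 * k) * a * b - k * (a + b) - c, b)"
    using entries b by (simp add: cohn_left_def entries12_def T Q P R S_mat_eq)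
  have "(p1 * r1 + a * r3 - k) * c + b * r4 = (r1 + r4) * b - k * c - (r1 * r4 - c * r3) * a"
    unfolding b[symmetric] by algebra
  also have "\<dots> = (3 + 3 * k) * b * c - k * (b + c) - a"
    unfolding r by algebra
  finally show "entries12 (cohn_right k T) = (b, (3 + 3 * k) * b * c - k * (b + c) - a, c)"
    using entries b by (simp add: cohn_right_def entries12_def T Q P R S_mat_eq)
qed

text \<open>The jump numerators are products of roots: the Markov equation, as a quadratic in the
  replaced entry, has the polynomial from \<open>entries12_cohn_step\<close> as its other
  root.\<close>

lemma cohn_step_vieta:
  assumes "cohn_triple k T"
  shows "rat_triple (entries12 (cohn_left k T)) = vieta_left k (entries12 T)"
    and "rat_triple (entries12 (cohn_right k T)) = vieta_right k (entries12 T)"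
proof -
  obtain a b c where e: "entries12 T = (a, b, c)" by (cases "entries12 T")
  have m: "markov_triple k (a, b, c)"
    using assms e by (auto simp: cohn_triple_def)
  then have nz: "a \<noteq> 0" "c \<noteq> 0" by (auto simp: markov_triple_def)
  have l: "a\<^sup>2 + k * a * b + b\<^sup>2 = ((3 + 3 * k) * a * b - k * (a + b) - c) * c"
    and r: "b\<^sup>2 + k * b * c + c\<^sup>2 = ((3 + 3 * k) * b * c - k * (b + c) - a) * a"
    using m by (auto simp: markov_triple_def algebra_simps power2_eq_square)
  \<comment> \<open>The instance of \<open>of_int_mult\<close> splits off just the factor
    \<open>c\<close>, which then cancels against the denominator.\<close>
  show "rat_triple (entries12 (cohn_left k T)) = vieta_left k (entries12 T)"
    unfolding entries12_cohn_step(1)[OF assms e] e rat_triple_def vieta_left_def prod.case l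
      of_int_mult[of _ c]
    using nz by simp
  show "rat_triple (entries12 (cohn_right k T)) = vieta_right k (entries12 T)"
    unfolding entries12_cohn_step(2)[OF assms e] e rat_triple_def vieta_right_def prod.case r
      of_int_mult[of _ a]
    using nz by simp
qed

theorem theorem1p10:
  fixes k :: int
  assumes "k \<ge> 0"
  shows "(\<forall>T a b c. cohn_triple_assoc k T (a, b, c) \<and> b \<ge> max a c \<longrightarrow>
            (\<exists>T0. cohn_triple_assoc k T0 (1, 1, 1) \<and> (cohn_step k)\<^sup>*\<^sup>* T0 T)) \<and>
         (\<forall>T. cohn_triple k T \<longrightarrow>
            rat_triple (entries12 (cohn_left k T)) = vieta_left k (entries12 T) \<and>
            rat_triple (entries12 (cohn_right k T)) = vieta_right k (entries12 T))"
  using cohn_triple_descent[OF assms] cohn_step_vieta by (metis max.bounded_iff)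

end
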